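(* For every infinite sequence $\mathcal S=(a_i)_{i\ge1}$ of elementary foldings, the folding pattern $P_{\mathcal S}$ is non-periodic: if $\mathbf t\in\mathbb R^2$ satisfies $P_{\mathcal S}+\mathbf t=P_{\mathcal S}$ (the translated colored edge set coincides with the original), then $\mathbf t=0$.
   Context: Grid: let $\xi_1=(0,-2\sqrt3)$ and let $\xi_2,\xi_3$ be its counterclockwise rotations by $2\pi/3$ and $4\pi/3$. For $i\in\{1,2,3\}$, $n\in\mathbb Z$ put $\ell_{i,n}=\{x\in\mathbb R^2:(x,\xi_i)=3n+1\}$. The union $\mathcal L$ of all $\ell_{i,n}$ is a triangular grid whose smallest triangles (unit triangles) are regular of side $1$; unit edges are the sides of unit triangles. $O$ is the origin and $T_0$ is the positive (vertex above its horizontal side) unit triangle centered at $O$; $(-2)^kT_0$ is its image under the homothety with center $O$ and ratio $(-2)^k$. Folding patterns: an elementary folding folds a paper regular triangle of side $2a$ along its three midsegments onto its central triangle of side $a$; it is a folding up ($+$) if all three folds go through the upper half-space of $\mathbb R^3$ and a folding down ($-$) if all go through the lower half-space. When unfolded, fold lines of a folding up become valleys and those of a folding down become peaks. For a finite sequence $(a_1,\dots,a_k)$ take the paper triangle $(-2)^kT_0$, perform $a_k$ first (onto $(-2)^{k-1}T_0$), then $a_{k-1}$, …, finally $a_1$ (onto $T_0$), then unfold; valleys are colored red and peaks blue, giving a coloring of the unit edges interior to $(-2)^kT_0$. For an infinite sequence $\mathcal S=(a_i)_{i\ge1}$, $P_{\mathcal S}$ is the red/blue coloring of all unit edges of $\mathcal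 L$ in which each edge gets its color from the pattern of $(a_1,\dots,a_k)$ for any $k$ with the edge interior to $(-2)^kT_0$ (independent of $k$). *)

theory Defs
  imports "HOL-Analysis.Analysis"
begin

definition ccw_rotation :: "real \<Rightarrow> real^2 \<Rightarrow> real^2" where
  "ccw_rotation \<theta> x = vector [cos \<theta> * x$1 - sin \<theta> * x$2, sin \<theta> * x$1 + cos \<theta> * x$2]"

definition xi :: "nat \<Rightarrow> real^2" where
  "xi i = ccw_rotation (2 * pi * (real i - 1) / 3) (vector [0, - 2 * sqrt 3])"

definition grid_line :: "nat \<Rightarrow> int \<Rightarrow> (real^2) set" where
  "grid_line i n = {x. x \<bullet> xi i = 3 * of_int n + 1}"

definition grid :: "(real^2) set" where
  "grid = (\<Union>i\<in>{1,2,3}. \<Union>n. grid_line i n)"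

text \<open>A segment contained in the grid lies on a single grid line, so a triangle with all its sides in
  the grid is cut out by three grid lines; the smallest such triangles are those of side 1.\<close>

definition unit_triangle :: "real^2 \<Rightarrow> real^2 \<Rightarrow> real^2 \<Rightarrow> bool" where
  "unit_triangle p q r \<longleftrightarrow>
     dist p q = 1 \<and> dist q r = 1 \<and> dist r p = 1 \<and>
     closed_segment p q \<subseteq> grid \<and> closed_segment q r \<subseteq> grid \<and> closed_segment r p \<subseteq> grid"

definition unit_edges :: "(real^2) set set" where
  "unit_edges = {closed_segment p q |p q. \<exists>r. unit_triangle p q r}"

definition T0 :: "(real^2) set" where
  "T0 = convex hull {vector [0, sqrt 3 / 3], vector [- 1 / 2, - sqrt 3 / 6], vector [1 / 2, - sqrt 3 / 6]}"

definition big_triangle :: "nat \<Rightarrow> (real^2) set" where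
  "big_triangle k = (\<lambda>x. (- 2) ^ k *\<^sub>R x) ` T0"

datatype folding = Up | Down

datatype colour = Red | Blue

definition mirror :: "nat \<Rightarrow> real \<Rightarrow> real^2 \<Rightarrow> real^2" where
  "mirror i c x = x - (2 * (x \<bullet> xi i - c) / (xi i \<bullet> xi i)) *\<^sub>R xi i"

text \<open>For \<open>k \<ge> 1\<close> the sides of the central triangle \<open>big_triangle (k - 1)\<close> of \<open>big_triangle k\<close> lie on
  the lines \<open>x \<bullet> xi i = c\<close> with \<open>c = (-2) ^ (k - 1)\<close>, and \<open>x \<bullet> xi i / c > 1\<close> says that \<open>x\<close> lies on the
  opposite side of this line from the origin. Since \<open>xi 1 + xi 2 + xi 3 = 0\<close>, a point of
  \<open>big_triangle k\<close> is beyond at most one of the three lines.\<close>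

definition beyond :: "nat \<Rightarrow> nat \<Rightarrow> real^2 \<Rightarrow> bool" where
  "beyond k i x \<longleftrightarrow> x \<bullet> xi i / (- 2) ^ (k - 1) > 1"

text \<open>The effect of an elementary folding of \<open>big_triangle k\<close> on positions: each corner triangle lands
  on the central triangle and is turned over. Positions do not depend on whether the folding is up
  or down.\<close>

definition fold_map :: "nat \<Rightarrow> real^2 \<Rightarrow> real^2" where
  "fold_map k x =
     (if beyond k 1 x then mirror 1 ((- 2) ^ (k - 1)) x
      else if beyond k 2 x then mirror 2 ((- 2) ^ (k - 1)) x
      else if beyond k 3 x then mirror 3 ((- 2) ^ (k - 1)) x
      else x)"

definition turned_over :: "nat \<Rightarrow> real^2 \<Rightarrow> bool" where
  "turned_over k x \<longleftrightarrow> (\<exists>i\<in>{1,2,3}. beyond k i x)"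

text \<open>\<open>position k m x\<close> is the place of the point \<open>x\<close> of the paper triangle \<open>big_triangle k\<close>, and
  \<open>faces_up k m x\<close> tells whether the originally upper side of the paper faces up at \<open>x\<close>, after the
  first \<open>m\<close> foldings; the next folding to be performed is the one of \<open>big_triangle (k - m)\<close>.\<close>

primrec position :: "nat \<Rightarrow> nat \<Rightarrow> real^2 \<Rightarrow> real^2" where
  "position k 0 x = x"
| "position k (Suc m) x = fold_map (k - m) (position k m x)"

primrec faces_up :: "nat \<Rightarrow> nat \<Rightarrow> real^2 \<Rightarrow> bool" where
  "faces_up k 0 x \<longleftrightarrow> True"
| "faces_up k (Suc m) x \<longleftrightarrow> (faces_up k m x \<noteq> turned_over (k - m) (position k m x))"

text \<open>All layers of the stack are folded together. On a layer facing up a folding up makes a valley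
  and a folding down a peak; on a layer lying upside down it is the other way round. Valleys are red,
  peaks are blue.\<close>

definition crease_colour :: "folding \<Rightarrow> bool \<Rightarrow> colour" where
  "crease_colour f up = (if (f = Up) = up then Red else Blue)"

definition interior_edge :: "nat \<Rightarrow> (real^2) set \<Rightarrow> bool" where
  "interior_edge k e \<longleftrightarrow> e \<in> unit_edges \<and> rel_interior e \<subseteq> interior (big_triangle k)"

text \<open>The folding \<open>a j\<close> is performed after \<open>k - j\<close> others and creases the parts of the paper that
  lie, at that moment, on the midsegments of \<open>big_triangle j\<close>, i.e. on the sides of
  \<open>big_triangle (j - 1)\<close>. Each interior edge is creased by exactly one \<open>a j\<close>. Relative interiors are
  used because end points of unit edges lie on several creases.\<close>

definition finite_pattern :: "(nat \<Rightarrow> folding) \<Rightarrow> nat \<Rightarrow> ((real^2) set \<times> colour) set" where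
  "finite_pattern a k = {(e, col). interior_edge k e \<and>
     (\<exists>j\<in>{1..k}. position k (k - j) ` rel_interior e \<subseteq> frontier (big_triangle (j - 1)) \<and>
        (\<forall>x\<in>rel_interior e. col = crease_colour (a j) (faces_up k (k - j) x)))}"

text \<open>The sequence is indexed from 1; the value \<open>a 0\<close> is irrelevant.\<close>

definition folding_pattern :: "(nat \<Rightarrow> folding) \<Rightarrow> ((real^2) set \<times> colour) set" where
  "folding_pattern a = (\<Union>k. finite_pattern a k)"

definition translate_pattern ::
    "real^2 \<Rightarrow> ((real^2) set \<times> colour) set \<Rightarrow> ((real^2) set \<times> colour) set" where
  "translate_pattern t P = (\<lambda>(e, col). ((\<lambda>x. x + t) ` e, col)) ` P"

end

theory Submission imports Defs begin

text \<open>In the coordinates \<open>x \<bullet> xi i\<close>, an edge on the grid line \<open>x \<bullet> xi i = v\<close> is creased by the folding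
  \<open>a (j + 1)\<close> where \<open>2 ^ j\<close> is the exact power of 2 dividing \<open>v\<close>. It is a midsegment of a
  triangle of the grid scaled by \<open>(- 2) ^ (j + 1)\<close>, and on which side the paper lies at that moment depends
  only on the orientation of that triangle. Hence the colours on this line come in alternating runs of
  length \<open>2 ^ j\<close>. A period \<open>t\<close> maps the line \<open>v\<close> to the line \<open>v + 3 * m\<close> with \<open>3 * m = t \<bullet> xi i\<close>; if
  \<open>m = 2 ^ s * r\<close> with \<open>r\<close> odd, then \<open>v = (- 2) ^ (s + 1)\<close> is sent to a line with shorter runs, which is
  absurd, so \<open>m = 0\<close>.\<close>

section \<open>Coordinates\<close>

lemma xi_components:
  "xi 1 $ 1 = 0" "xi 1 $ 2 = - 2 * sqrt 3"
  "xi 2 $ 1 = 3" "xi 2 $ 2 = sqrt 3"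
  "xi 3 $ 1 = - 3" "xi 3 $ 2 = sqrt 3"
proof -
  have c: "cos (4 * pi / 3) = - 1 / 2" "sin (4 * pi / 3) = - sqrt 3 / 2"
    using cos_periodic_pi[of "pi / 3"] sin_periodic_pi[of "pi / 3"] cos_60 sin_60
    by (simp_all add: add_divide_distrib[symmetric])
  show "xi 1 $ 1 = 0" "xi 1 $ 2 = - 2 * sqrt 3"
    "xi 2 $ 1 = 3" "xi 2 $ 2 = sqrt 3"
    by (simp_all add: xi_def ccw_rotation_def cos_120 sin_120)
  show "xi 3 $ 1 = - 3" "xi 3 $ 2 = sqrt 3"
    by (simp_all add: xi_def ccw_rotation_def c)
qed

lemma inner_xi_xi:
  assumes "i \<in> {1, 2, 3}" "l \<in> {1, 2, 3}"
  shows "xi i \<bullet> xi l = (if i = l then 12 else - 6)"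
  using assms by (auto simp: inner_vec_def sum_2 xi_components xi_components[unfolded One_nat_def])

lemma inner_xi_explicit:
  "x \<bullet> xi 1 = - 2 * sqrt 3 * x $ 2"
  "x \<bullet> xi 2 = 3 * x $ 1 + sqrt 3 * x $ 2"
  "x \<bullet> xi 3 = - 3 * x $ 1 + sqrt 3 * x $ 2"
  by (simp_all add: inner_vec_def sum_2 xi_components xi_components[unfolded One_nat_def])

lemmas inner_xi_simps = inner_xi_explicit inner_xi_explicit(1)[unfolded One_nat_def]

text \<open>Naming the three directions \<open>i\<close>, \<open>b\<close>, \<open>c\<close> in any
  order lets later arguments treat a line of arbitrary direction \<open>i\<close> once instead of in
  three cases.\<close>

lemma distinct_xi_indices:
  assumes "{i, b, c} = {1, 2, 3 :: nat}"
  shows "distinct [i, b, c]"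
proof -
  have "card {i, b, c} = 3" unfolding assms by simp
  then show ?thesis by (intro card_distinct) simp
qed

lemma sum_inner_xi:
  assumes "{i, b, c} = {1, 2, 3 :: nat}"
  shows "x \<bullet> xi i + x \<bullet> xi b + x \<bullet> xi c = 0"
proof -
  have "distinct [i, b, c]" using assms by (rule distinct_xi_indices)
  then have "x \<bullet> xi i + x \<bullet> xi b + x \<bullet> xi c = (\<Sum>l\<in>{i, b, c}. x \<bullet> xi l)" by simp
  also have "\<dots> = 0" unfolding assms by (simp add: inner_xi_simps)
  finally show ?thesis .
qed

text \<open>The vectors \<open>xi i\<close> form a tight frame of the plane, so lengths and angles
  can be computed from the three redundant coordinates.\<close>

lemma inner_eq_sum_xi:
  assumes "{i, b, c} = {1, 2, 3 :: nat}"
  shows "18 * (x \<bullet> y) =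
    (x \<bullet> xi i) * (y \<bullet> xi i) + (x \<bullet> xi b) * (y \<bullet> xi b) + (x \<bullet> xi c) * (y \<bullet> xi c)"
proof -
  have "distinct [i, b, c]" using assms by (rule distinct_xi_indices)
  then have "(x \<bullet> xi i) * (y \<bullet> xi i) + (x \<bullet> xi b) * (y \<bullet> xi b) + (x \<bullet> xi c) * (y \<bullet> xi c)
    = (\<Sum>l\<in>{i, b, c}. (x \<bullet> xi l) * (y \<bullet> xi l))" by simp
  also have "\<dots> = (x \<bullet> xi 1) * (y \<bullet> xi 1) + (x \<bullet> xi 2) * (y \<bullet> xi 2) + (x \<bullet> xi 3) * (y \<bullet> xi 3)"
    unfolding assms by simp
  also have "\<dots> = 18 * (x $ 1 * y $ 1) + (sqrt 3 * sqrt 3) * 6 * (x $ 2 * y $ 2)"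
    unfolding inner_xi_explicit by (simp add: algebra_simps del: real_sqrt_mult_self)
  also have "\<dots> = 18 * (x \<bullet> y)" by (simp add: inner_vec_def sum_2)
  finally show ?thesis by simp
qed

lemma xi_permutationE:
  assumes "i \<in> {1, 2, 3 :: nat}"
  obtains b c where "{i, b, c} = {1, 2, 3}"
proof -
  have "\<exists>b c. {i, b, c} = {1, 2, 3}"
  proof -
    consider "i = 1" | "i = 2" | "i = 3" using assms by auto
    then show ?thesis by cases (blast intro: insert_commute)+
  qed
  then show thesis using that by blast
qed

section \<open>The triangles\<close>

lemma mem_T0_iff: "x \<in> T0 \<longleftrightarrow> (\<forall>i\<in>{1, 2, 3}. x \<bullet> xi i \<le> 1)"
proof
  assume "x \<in> T0"
  then show "\<forall>i\<in>{1, 2, 3}. x \<bullet> xi i \<le> 1"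
    unfolding T0_def convex_hull_3
    by (auto simp: inner_xi_simps algebra_simps)
next
  assume x: "\<forall>i\<in>{1, 2, 3}. x \<bullet> xi i \<le> 1"
  \<comment> \<open>Barycentric coordinates: \<open>?u i\<close> vanishes on the side
    \<open>x \<bullet> xi i = 1\<close> and is 1 at the opposite vertex.\<close>
  let ?u = "\<lambda>i. (1 - x \<bullet> xi i) / 3"
  have s: "x \<bullet> xi 1 + x \<bullet> xi 2 + x \<bullet> xi 3 = 0" by (rule sum_inner_xi) simp
  have "x = ?u 1 *\<^sub>R vector [0, sqrt 3 / 3] + ?u 2 *\<^sub>R vector [- 1 / 2, - sqrt 3 / 6]
      + ?u 3 *\<^sub>R vector [1 / 2, - sqrt 3 / 6]"
    by (simp add: vec_eq_iff forall_2 inner_xi_simps field_simps)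
  moreover have "?u 1 + ?u 2 + ?u 3 = 1" using s by (simp add: field_simps)
  ultimately show "x \<in> T0"
    unfolding T0_def convex_hull_3 using x by (smt (verit, best) mem_Collect_eq divide_nonneg_pos insertCI)
qed

lemma mem_big_triangle_iff:
  "x \<in> big_triangle k \<longleftrightarrow> (\<forall>i\<in>{1, 2, 3}. x \<bullet> xi i / (- 2) ^ k \<le> 1)"
proof -
  have "x \<in> big_triangle k \<longleftrightarrow> (1 / (- 2) ^ k) *\<^sub>R x \<in> T0"
    unfolding big_triangle_def by (auto intro!: image_eqI[where x = "(1 / (- 2) ^ k) *\<^sub>R x"])
  then show ?thesis unfolding mem_T0_iff by (simp add: divide_inverse mult.commute)
qed

lemma interior_big_triangle:
  "interior (big_triangle k) = {x. \<forall>i\<in>{1, 2, 3}. x \<bullet> xi i / (- 2) ^ k < 1}" (is "_ = ?S")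
proof
  show "interior (big_triangle k) \<subseteq> ?S"
  proof (intro subsetI CollectI ballI)
    fix x and i :: nat assume x: "x \<in> interior (big_triangle k)" and i: "i \<in> {1, 2, 3}"
    let ?a = "(1 / (- 2) ^ k) *\<^sub>R xi i"
    have "xi i \<bullet> xi i = 12" using i by (simp add: inner_xi_xi)
    then have a: "?a \<noteq> 0" by auto
    have "big_triangle k \<subseteq> {x. ?a \<bullet> x \<le> 1}"
      using i by (auto simp: mem_big_triangle_iff inner_commute)
    then have "x \<in> interior {x. ?a \<bullet> x \<le> 1}" using x interior_mono by blast
    then show "x \<bullet> xi i / (- 2) ^ k < 1" using interior_halfspace_le[OF a, of 1]
      by (simp add: inner_commute)
  qed
  have "?S = (\<Inter>i\<in>{1, 2, 3}. {x. x \<bullet> xi i / (- 2) ^ k < 1})" by auto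
  then have "open ?S"
    by (simp only:) (intro open_INT ballI open_Collect_less continuous_intros; simp)
  then show "?S \<subseteq> interior (big_triangle k)"
    by (intro interior_maximal) (auto simp: mem_big_triangle_iff intro: less_imp_le)
qed

lemma frontier_big_triangle:
  "frontier (big_triangle k) =
     {x. x \<in> big_triangle k \<and> (\<exists>i\<in>{1, 2, 3}. x \<bullet> xi i = (- 2) ^ k)}"
proof -
  have "big_triangle k = (\<Inter>i\<in>{1, 2, 3}. {x. x \<bullet> xi i / (- 2) ^ k \<le> 1})"
    by (auto simp: mem_big_triangle_iff)
  then have "closed (big_triangle k)"
    by (auto intro!: closed_Collect_le continuous_intros)
  moreover have "x \<notin> interior (big_triangle k) \<longleftrightarrow> (\<exists>i\<in>{1, 2, 3}. x \<bullet> xi i = (- 2) ^ k)"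
    if "x \<in> big_triangle k" for x
  proof -
    have "x \<bullet> xi i / (- 2) ^ k < 1 \<longleftrightarrow> x \<bullet> xi i \<noteq> (- 2) ^ k" if "i \<in> {1, 2, 3}" for i
      using that \<open>x \<in> big_triangle k\<close> unfolding mem_big_triangle_iff
      by (metis divide_eq_1_iff less_eq_real_def less_irrefl power_not_zero zero_neq_neg_numeral)
    then show ?thesis by (auto simp: interior_big_triangle)
  qed
  ultimately show ?thesis unfolding frontier_def by auto
qed

section \<open>Folding modulo the grid\<close>

text \<open>For \<open>i \<noteq> l\<close> the reflection adds \<open>x \<bullet> xi l - c\<close>
  to coordinate \<open>i\<close>. As the coordinates sum to 0, the result is \<open>- c\<close>
  minus the third coordinate, whose index is \<open>6 - l - i\<close>.\<close>

lemma inner_mirror: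
  assumes "l \<in> {1, 2, 3}" "i \<in> {1, 2, 3}"
  shows "mirror l c x \<bullet> xi i =
    (if i = l then 2 * c - x \<bullet> xi l else - c - x \<bullet> xi (6 - l - i))"
proof -
  have "x \<bullet> xi 1 + x \<bullet> xi 2 + x \<bullet> xi 3 = 0" by (rule sum_inner_xi) simp
  moreover have "mirror l c x \<bullet> xi i = x \<bullet> xi i - (x \<bullet> xi l - c) / 6 * (xi l \<bullet> xi i)"
    using inner_xi_xi[OF assms(1) assms(1)] by (simp add: mirror_def inner_diff_left field_simps)
  ultimately show ?thesis
    using assms inner_xi_xi[OF assms] by (auto simp: field_simps)
qed

text \<open>Every element of the group generated by the reflections in the lines
  \<open>x \<bullet> xi i = (3 * n + 1) * c\<close> acts on the three coordinates, up to a permutation and modulo \<open>3 * c\<close>,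
  as the identity if it preserves orientation and as \<open>z \<mapsto> - c - z\<close> if it reverses it.\<close>

definition folds_to :: "real \<Rightarrow> bool \<Rightarrow> real^2 \<Rightarrow> real^2 \<Rightarrow> bool" where
  "folds_to c up x y \<longleftrightarrow> (\<exists>\<pi>. bij_betw \<pi> {1, 2, 3} {1, 2, 3 :: nat} \<and>
     (\<forall>i\<in>{1, 2, 3}. \<exists>n::int.
        y \<bullet> xi i = (if up then x \<bullet> xi (\<pi> i) else - c - x \<bullet> xi (\<pi> i)) + 3 * c * n))"

lemma folds_to_refl: "folds_to c True x x"
  unfolding folds_to_def by (rule exI[of _ id]) (auto intro: exI[of _ 0])

text \<open>The numbers \<open>2 * c\<close> and \<open>- c\<close> agree modulo
  \<open>3 * c\<close>, and \<open>6 * c\<close> is a multiple of \<open>3 * c\<close>.\<close>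

lemma folds_to_refine:
  assumes "folds_to (- 2 * c) up x y"
  shows "folds_to c up x y"
proof -
  have "\<exists>n'::int. y \<bullet> xi i = (if up then w else - c - w) + 3 * c * n'"
    if "y \<bullet> xi i = (if up then w else - (- 2 * c) - w) + 3 * (- 2 * c) * n" for i w and n :: int
    using that by (intro exI[of _ "if up then - 2 * n else 1 - 2 * n"]) (auto simp: algebra_simps)
  then show ?thesis using assms unfolding folds_to_def by meson
qed

text \<open>Since \<open>2 * c\<close> and \<open>- c\<close> agree modulo \<open>3 * c\<close>, the
  reflection acts on every coordinate as \<open>z \<mapsto> - c - z\<close>, apart from swapping two
  of them. This map is an involution, so composing with it toggles the orientation.\<close>

lemma folds_to_mirror:
  assumes "folds_to c up x y" "l \<in> {1, 2, 3}"
  shows "folds_to c (\<not> up) x (mirror l c y)"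
proof -
  obtain \<pi> where \<pi>: "bij_betw \<pi> {1, 2, 3} {1, 2, 3 :: nat}"
    and y: "\<And>i. i \<in> {1, 2, 3} \<Longrightarrow> \<exists>n::int.
        y \<bullet> xi i = (if up then x \<bullet> xi (\<pi> i) else - c - x \<bullet> xi (\<pi> i)) + 3 * c * n"
    using assms(1) unfolding folds_to_def by auto
  define s where "s i = (if i = l then l else 6 - l - i)" for i
  have s: "s i \<in> {1, 2, 3}" if "i \<in> {1, 2, 3}" for i
    using that assms(2) by (auto simp: s_def)
  have "s (s i) = i" if "i \<in> {1, 2, 3}" for i
    using that assms(2) by (auto simp: s_def)
  then have "bij_betw s {1, 2, 3} {1, 2, 3}"
    using s by (intro bij_betwI[of s _ _ s]) auto
  then have "bij_betw (\<pi> \<circ> s) {1, 2, 3} {1, 2, 3}" using \<pi> by (rule bij_betw_trans)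
  moreover have "\<exists>n::int. mirror l c y \<bullet> xi i =
      (if \<not> up then x \<bullet> xi ((\<pi> \<circ> s) i) else - c - x \<bullet> xi ((\<pi> \<circ> s) i)) + 3 * c * n"
    if i: "i \<in> {1, 2, 3}" for i
  proof -
    obtain n :: int where "y \<bullet> xi (s i) =
        (if up then x \<bullet> xi (\<pi> (s i)) else - c - x \<bullet> xi (\<pi> (s i))) + 3 * c * n"
      using y[OF s[OF i]] by blast
    moreover have "mirror l c y \<bullet> xi i = - c - y \<bullet> xi (s i) + 3 * c * (if i = l then 1 else 0)"
      using inner_mirror[OF assms(2) i] by (auto simp: s_def)
    ultimately show ?thesis
      by (intro exI[of _ "(if i = l then 1 else 0) - n"]) (auto simp: algebra_simps)
  qed
  ultimately show ?thesis unfolding folds_to_def by blast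
qed

section \<open>The invariant of the folding process\<close>

text \<open>In units of \<open>(- 2) ^ n\<close> the large triangle is where all coordinates are at
  least -2, the small one where all are at most 1. The reflection turns a coordinate
  \<open>q > 1\<close> into \<open>2 - q\<close>, and values \<open>q \<ge> - 2\<close> of the other
  two into \<open>- 1 - q\<close>.\<close>

lemma mirror_mem_big_triangle:
  assumes "y \<in> big_triangle (Suc n)" "l \<in> {1, 2, 3}" "beyond (Suc n) l y"
  shows "mirror l ((- 2) ^ n) y \<in> big_triangle n"
proof -
  let ?c = "(- 2) ^ n :: real"
  have c: "?c \<noteq> 0" by simp
  have ge: "y \<bullet> xi i / ?c \<ge> - 2" if "i \<in> {1, 2, 3}" for i
    using that assms(1) unfolding mem_big_triangle_iff by auto
  have "mirror l ?c y \<bullet> xi i / ?c \<le> 1" if i: "i \<in> {1, 2, 3}" for i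
  proof (cases "i = l")
    case True
    then have "mirror l ?c y \<bullet> xi i / ?c = 2 - y \<bullet> xi l / ?c"
      using inner_mirror[OF assms(2) i] c by (simp add: diff_divide_distrib)
    then show ?thesis using assms(3) by (simp add: beyond_def)
  next
    case False
    then have "mirror l ?c y \<bullet> xi i / ?c = - 1 - y \<bullet> xi (6 - l - i) / ?c"
      using inner_mirror[OF assms(2) i] c by (simp add: diff_divide_distrib)
    moreover have "6 - l - i \<in> {1, 2, 3}" using False assms(2) i by auto
    ultimately show ?thesis using ge by fastforce
  qed
  then show ?thesis unfolding mem_big_triangle_iff by blast
qed

lemma turned_overE:
  assumes "turned_over (Suc n) y"
  obtains l where "l \<in> {1, 2, 3}" "beyond (Suc n) l y" "fold_map (Suc n) y = mirror l ((- 2) ^ n) y"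
proof -
  consider "beyond (Suc n) 1 y" | "\<not> beyond (Suc n) 1 y" "beyond (Suc n) 2 y"
    | "\<not> beyond (Suc n) 1 y" "\<not> beyond (Suc n) 2 y" "beyond (Suc n) 3 y"
    using assms unfolding turned_over_def by blast
  then show thesis
  proof cases
    case 1
    then show ?thesis using that[of 1] by (simp add: fold_map_def)
  next
    case 2
    then show ?thesis using that[of 2] by (simp add: fold_map_def)
  next
    case 3
    then show ?thesis using that[of 3] by (simp add: fold_map_def)
  qed
qed

text \<open>Induction over the foldings. The scale is refined before each reflection, because the
  mirror line belongs to the finer grid but not to the coarser one.\<close>

lemma position_folds_to:
  assumes "x \<in> big_triangle k" "m \<le> k"
  shows "position k m x \<in> big_triangle (k - m) \<and>
    folds_to ((- 2) ^ (k - m)) (faces_up k m x) x (position k m x)"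
  using assms(2)
proof (induction m)
  case 0
  then show ?case using assms(1) folds_to_refl by simp
next
  case (Suc m)
  define n where "n = k - Suc m"
  have n: "k - m = Suc n" using Suc.prems by (simp add: n_def)
  let ?y = "position k m x" and ?up = "faces_up k m x"
  have y: "?y \<in> big_triangle (Suc n)" and "folds_to ((- 2) ^ Suc n) ?up x ?y"
    using Suc.IH[OF Suc_leD[OF Suc.prems]] unfolding n by blast+
  then have f: "folds_to ((- 2) ^ n) ?up x ?y" using folds_to_refine[of "(- 2) ^ n"] by simp
  show ?case
  proof (cases "turned_over (Suc n) ?y")
    case True
    then obtain l where l: "l \<in> {1, 2, 3}" "beyond (Suc n) l ?y"
      and "fold_map (Suc n) ?y = mirror l ((- 2) ^ n) ?y"
      by (rule turned_overE)
    then have p: "position k (Suc m) x = mirror l ((- 2) ^ n) ?y" by (simp add: n)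
    have "faces_up k (Suc m) x = (\<not> ?up)" using True by (simp add: n)
    then show ?thesis
      using mirror_mem_big_triangle[OF y l] folds_to_mirror[OF f l(1)] p
      by (simp del: position.simps faces_up.simps add: n_def)
  next
    case False
    then have "position k (Suc m) x = ?y" "faces_up k (Suc m) x = ?up"
      by (auto simp: fold_map_def turned_over_def n)
    moreover have "?y \<in> big_triangle n"
      unfolding mem_big_triangle_iff using False by (auto simp: turned_over_def beyond_def not_less)
    ultimately show ?thesis using f by (simp del: position.simps faces_up.simps add: n_def)
  qed
qed

text \<open>A point off the grid scaled by \<open>c\<close> lies in the cell given by
  \<open>3 * n i - 2 < x \<bullet> xi i / c < 3 * n i + 1\<close>, where the sum of the \<open>n i\<close> is 0 or 1: it is 0 exactly
  for the cells that are translates of the one containing the origin.\<close>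

definition cell :: "real \<Rightarrow> real^2 \<Rightarrow> nat \<Rightarrow> int" where
  "cell c x i = \<lceil>(x \<bullet> xi i / c - 1) / 3\<rceil>"

definition upright :: "real \<Rightarrow> real^2 \<Rightarrow> bool" where
  "upright c x \<longleftrightarrow> (\<Sum>i\<in>{1, 2, 3}. cell c x i) = 0"

lemma cell_eqI:
  assumes "3 * of_int n - 2 < x \<bullet> xi i / c" "x \<bullet> xi i / c \<le> 3 * of_int n + 1"
  shows "cell c x i = n"
  unfolding cell_def by (rule ceiling_unique) (use assms in \<open>auto simp: field_simps\<close>)

text \<open>The point \<open>y\<close> lies in the cell of the origin, so the multiples of
  \<open>3 * c\<close> separating the coordinates of \<open>x\<close> and \<open>y\<close> determine
  the cell of \<open>x\<close>. As both coordinate sums are 0, these multiples add up to 0 for a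
  preserved orientation and to 1 for a reversed one.\<close>

lemma folds_to_imp_upright:
  assumes f: "folds_to c up x y" and c: "c \<noteq> 0"
    and y: "\<forall>i\<in>{1, 2, 3}. y \<bullet> xi i / c \<le> 1"
    and off: "\<And>i n. i \<in> {1, 2, 3} \<Longrightarrow> x \<bullet> xi i \<noteq> c * (3 * of_int n + 1)"
  shows "up \<longleftrightarrow> upright c x"
proof -
  obtain \<pi> where \<pi>: "bij_betw \<pi> {1, 2, 3} {1, 2, 3 :: nat}"
    and "\<forall>i\<in>{1, 2, 3}. \<exists>n::int.
        y \<bullet> xi i = (if up then x \<bullet> xi (\<pi> i) else - c - x \<bullet> xi (\<pi> i)) + 3 * c * n"
    using f unfolding folds_to_def by auto
  then obtain n :: "nat \<Rightarrow> int" where n: "\<And>i. i \<in> {1, 2, 3} \<Longrightarrow>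
        y \<bullet> xi i = (if up then x \<bullet> xi (\<pi> i) else - c - x \<bullet> xi (\<pi> i)) + 3 * c * n i"
    by metis
  have in\<pi>: "\<pi> i \<in> {1, 2, 3}" if "i \<in> {1, 2, 3}" for i
    using bij_betwE[OF \<pi>] that by blast
  define q where "q i = y \<bullet> xi i / c" for i
  define w where "w i = x \<bullet> xi i / c" for i
  have q: "q i = (if up then w (\<pi> i) else - 1 - w (\<pi> i)) + 3 * n i" if "i \<in> {1, 2, 3}" for i
    using n[OF that] c by (auto simp: q_def w_def field_simps)
  have w: "w i \<noteq> 3 * of_int m + 1" if "i \<in> {1, 2, 3}" for i m
    using off[OF that, of m] c by (auto simp: w_def field_simps)
  have sq: "q 1 + q 2 + q 3 = 0" and sw: "w 1 + w 2 + w 3 = 0"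
    using sum_inner_xi[of 1 2 3 x] sum_inner_xi[of 1 2 3 y]
    by (simp_all add: q_def w_def add_divide_distrib[symmetric])
  have le: "q i \<le> 1" if "i \<in> {1, 2, 3}" for i using y that by (auto simp: q_def)
  have lt: "q i < 1" if i: "i \<in> {1, 2, 3}" for i
  proof -
    \<comment> \<open>Equality would put \<open>x\<close> on a line of the grid scaled by
      \<open>c\<close>.\<close>
    have "q i \<noteq> 1"
      using q[OF i] w[OF in\<pi>[OF i], of "if up then - n i else n i - 1"] by (auto split: if_splits)
    then show ?thesis using le[OF i] by simp
  qed
  have gt: "q i > - 2" if i: "i \<in> {1, 2, 3}" for i
    using i lt[of 1] lt[of 2] lt[of 3] sq by auto
  have "cell c x (\<pi> i) = (if up then - n i else n i)" if i: "i \<in> {1, 2, 3}" for i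
    using lt[OF i] gt[OF i] q[OF i] by (intro cell_eqI) (auto simp: w_def split: if_splits)
  then have "(\<Sum>i\<in>{1, 2, 3}. cell c x (\<pi> i)) = (\<Sum>i\<in>{1, 2, 3}. if up then - n i else n i)"
    by (intro sum.cong) auto
  moreover have "(\<Sum>i\<in>{1, 2, 3}. cell c x (\<pi> i)) = (\<Sum>i\<in>{1, 2, 3}. cell c x i)"
    using sum.reindex_bij_betw[OF \<pi>] .
  moreover have "(\<Sum>i\<in>{1, 2, 3}. w (\<pi> i)) = (\<Sum>i\<in>{1, 2, 3}. w i)"
    using sum.reindex_bij_betw[OF \<pi>] .
  then have "w (\<pi> 1) + w (\<pi> 2) + w (\<pi> 3) = 0" using sw by simp
  then have "of_int (n 1 + n 2 + n 3) = (if up then 0 else 1 :: real)"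
    using q[of 1] q[of 2] q[of 3] sq by (auto split: if_splits)
  then have "n 1 + n 2 + n 3 = (if up then 0 else 1)" by (auto split: if_splits)
  ultimately show ?thesis unfolding upright_def by (auto split: if_splits)
qed

section \<open>Unit edges\<close>

definition grid_vertex :: "real^2 \<Rightarrow> bool" where
  "grid_vertex p \<longleftrightarrow> (\<forall>i\<in>{1, 2, 3}. \<exists>n::int. p \<bullet> xi i = 3 * n + 1)"

lemma grid_vertexI:
  assumes p: "{i, b, c} = {1, 2, 3 :: nat}"
    and "x \<bullet> xi i = 3 * of_int m + 1" "x \<bullet> xi b = 3 * of_int n + 1"
  shows "grid_vertex x"
proof -
  have "x \<bullet> xi c = 3 * of_int (- m - n - 1) + 1"
    using sum_inner_xi[OF p, of x] assms(2,3) by simp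
  then have "\<forall>l\<in>{i, b, c}. \<exists>n::int. x \<bullet> xi l = 3 * n + 1" using assms(2,3) by blast
  then show ?thesis unfolding grid_vertex_def p .
qed

text \<open>An uncountable segment is covered by countably many grid lines, so one of them contains
  two of its points and hence both ends.\<close>

lemma segment_in_grid_on_line:
  assumes "p \<noteq> q" "closed_segment p q \<subseteq> grid"
  obtains i n where "i \<in> {1, 2, 3}" "p \<bullet> xi i = 3 * of_int n + 1" "q \<bullet> xi i = 3 * of_int n + 1"
proof -
  let ?S = "closed_segment p q"
  have "\<exists>i\<in>{1, 2, 3}. \<exists>n. uncountable (?S \<inter> grid_line i n)"
  proof (rule ccontr)
    assume "\<not> ?thesis"
    then have "countable (\<Union>i\<in>{1, 2, 3}. \<Union>n. ?S \<inter> grid_line i n)"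
      by (intro countable_UN) auto
    moreover have "?S = (\<Union>i\<in>{1, 2, 3}. \<Union>n. ?S \<inter> grid_line i n)"
      using assms(2) unfolding grid_def by blast
    ultimately show False using uncountable_closed_segment[OF assms(1)] by (simp only:)
  qed
  then obtain i n where i: "i \<in> {1, 2, 3}" and u: "uncountable (?S \<inter> grid_line i n)" by blast
  obtain y where y: "y \<in> ?S \<inter> grid_line i n" using u by (metis countable_empty all_not_in_conv)
  obtain z where z: "z \<in> ?S \<inter> grid_line i n" "z \<noteq> y"
    using u by (metis countable_empty countable_insert countable_subset insertI1 subsetI)
  from y obtain s where s: "y = (1 - s) *\<^sub>R p + s *\<^sub>R q" by (auto simp: in_segment)
  from z obtain s' where s': "z = (1 - s') *\<^sub>R p + s' *\<^sub>R q" by (auto simp: in_segment)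
  have "s \<noteq> s'" using s s' z by auto
  have 1: "(1 - s) * (p \<bullet> xi i) + s * (q \<bullet> xi i) = 3 * of_int n + 1"
    and 2: "(1 - s') * (p \<bullet> xi i) + s' * (q \<bullet> xi i) = 3 * of_int n + 1"
    using y z s s' by (simp_all add: grid_line_def inner_add_left)
  then have "(s - s') * (q \<bullet> xi i - p \<bullet> xi i) = 0" by (simp add: algebra_simps)
  then have "q \<bullet> xi i = p \<bullet> xi i" using \<open>s \<noteq> s'\<close> by simp
  with 1 have "p \<bullet> xi i = 3 * of_int n + 1" by (simp add: algebra_simps)
  with \<open>q \<bullet> xi i = p \<bullet> xi i\<close> i that show thesis by simp
qed

text \<open>The two sides at \<open>p\<close> lie on grid lines of different directions, and two
  coordinates of the right form force the third.\<close>

lemma unit_triangle_grid_vertex: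
  assumes "unit_triangle p q r"
  shows "grid_vertex p"
proof -
  have d: "dist p q = 1" "dist q r = 1" "dist r p = 1"
    and g: "closed_segment p q \<subseteq> grid" "closed_segment r p \<subseteq> grid"
    using assms unfolding unit_triangle_def by auto
  then have "p \<noteq> q" "r \<noteq> p" by auto
  obtain i m where i: "i \<in> {1, 2, 3}" and im: "p \<bullet> xi i = 3 * of_int m + 1" "q \<bullet> xi i = 3 * of_int m + 1"
    using segment_in_grid_on_line[OF \<open>p \<noteq> q\<close> g(1)] by blast
  obtain l n where l: "l \<in> {1, 2, 3}" and ln: "r \<bullet> xi l = 3 * of_int n + 1" "p \<bullet> xi l = 3 * of_int n + 1"
    using segment_in_grid_on_line[OF \<open>r \<noteq> p\<close> g(2)] by blast
  \<comment> \<open>Otherwise \<open>q - p\<close> and \<open>r - p\<close> would be parallel unit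
    vectors with inner product 1/2. In coordinates, parallelism leaves a single free value for each
    vector, with squares 9 and product 9/2.\<close>
  have "i \<noteq> l"
  proof
    assume "i = l"
    obtain b c where bc: "{i, b, c} = {1, 2, 3}" using i by (rule xi_permutationE)
    define x where "x = q - p"
    define y where "y = r - p"
    have x: "x \<bullet> xi i = 0" and y: "y \<bullet> xi i = 0"
      using im ln \<open>i = l\<close> by (simp_all add: x_def y_def inner_diff_left)
    have xx: "x \<bullet> x = 1" and yy: "y \<bullet> y = 1" and "(x - y) \<bullet> (x - y) = 1"
      using d by (simp_all add: x_def y_def dist_norm flip: norm_eq_1) (simp_all add: norm_minus_commute)
    then have xy: "x \<bullet> y = 1 / 2" by (simp add: inner_diff_left inner_diff_right inner_commute)
    have xc: "x \<bullet> xi c = - (x \<bullet> xi b)" and yc: "y \<bullet> xi c = - (y \<bullet> xi b)"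
      using sum_inner_xi[OF bc, of x] sum_inner_xi[OF bc, of y] x y by simp_all
    have "(x \<bullet> xi b) * (x \<bullet> xi b) = 9" "(y \<bullet> xi b) * (y \<bullet> xi b) = 9"
      and "(x \<bullet> xi b) * (y \<bullet> xi b) = 9 / 2"
      using inner_eq_sum_xi[OF bc, of x x] inner_eq_sum_xi[OF bc, of y y] inner_eq_sum_xi[OF bc, of x y]
        xx yy xy x y xc yc by simp_all
    moreover have "((x \<bullet> xi b) * (x \<bullet> xi b)) * ((y \<bullet> xi b) * (y \<bullet> xi b))
        = ((x \<bullet> xi b) * (y \<bullet> xi b)) * ((x \<bullet> xi b) * (y \<bullet> xi b))" by simp
    ultimately have "(9 :: real) * 9 = 9 / 2 * (9 / 2)" by metis
    then show False by simp
  qed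
  have "{i, l, 6 - i - l} = {1, 2, 3}" using i l \<open>i \<noteq> l\<close> by auto
  then show ?thesis using im(1) ln(2) by (rule grid_vertexI)
qed

lemma unit_edge_grid_vertex:
  assumes "closed_segment p q \<in> unit_edges"
  shows "grid_vertex p"
proof -
  obtain p' q' r where e: "closed_segment p q = closed_segment p' q'" and t: "unit_triangle p' q' r"
    using assms unfolding unit_edges_def by blast
  from t have "unit_triangle q' p' r"
    unfolding unit_triangle_def by (simp add: dist_commute closed_segment_commute)
  with t have "grid_vertex p'" "grid_vertex q'" using unit_triangle_grid_vertex by blast+
  moreover have "p \<in> {p', q'}" using e by (auto simp: closed_segment_eq)
  ultimately show ?thesis by blast
qed

section \<open>Edges given by a vertex and a direction\<close>

text \<open>If \<open>i\<close> is the remaining index, this is the unit step along lines of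
  direction \<open>i\<close>: it raises coordinate \<open>b\<close> by 3 and lowers coordinate
  \<open>c\<close> by 3, leading from a vertex to the next one.\<close>

definition edge_vector :: "nat \<Rightarrow> nat \<Rightarrow> real^2" where
  "edge_vector b c = (1 / 6) *\<^sub>R (xi b - xi c)"

lemma inner_edge_vector:
  assumes "{i, b, c} = {1, 2, 3 :: nat}"
  shows "edge_vector b c \<bullet> xi i = 0" "edge_vector b c \<bullet> xi b = 3" "edge_vector b c \<bullet> xi c = - 3"
proof -
  have m: "i \<in> {1, 2, 3}" "b \<in> {1, 2, 3}" "c \<in> {1, 2, 3}" using assms by blast+
  have "distinct [i, b, c]" using assms by (rule distinct_xi_indices)
  then show "edge_vector b c \<bullet> xi i = 0" "edge_vector b c \<bullet> xi b = 3" "edge_vector b c \<bullet> xi c = - 3"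
    using inner_xi_xi m by (auto simp: edge_vector_def inner_diff_left)
qed

lemma norm_edge_vector:
  assumes "{i, b, c} = {1, 2, 3 :: nat}"
  shows "norm (edge_vector b c) = 1"
  using inner_eq_sum_xi[OF assms, of "edge_vector b c" "edge_vector b c"] inner_edge_vector[OF assms]
  by (simp add: norm_eq_1)

lemma closed_segment_subset_grid:
  assumes "i \<in> {1, 2, 3}" "p \<bullet> xi i = 3 * of_int n + 1" "q \<bullet> xi i = 3 * of_int n + 1"
  shows "closed_segment p q \<subseteq> grid"
proof -
  have "closed_segment p q \<subseteq> grid_line i n"
  proof
    fix y assume "y \<in> closed_segment p q"
    then obtain s where "y = (1 - s) *\<^sub>R p + s *\<^sub>R q" by (auto simp: in_segment)
    then show "y \<in> grid_line i n" using assms(2,3) by (simp add: grid_line_def inner_add_left) (simp add: algebra_simps)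
  qed
  then show ?thesis using assms(1) unfolding grid_def by blast
qed

lemma unit_edgeI:
  assumes v: "grid_vertex p" and bc: "{i, b, c} = {1, 2, 3 :: nat}"
  shows "closed_segment p (p + edge_vector b c) \<in> unit_edges"
proof -
  have m: "i \<in> {1, 2, 3}" "b \<in> {1, 2, 3}" "c \<in> {1, 2, 3}" using bc by blast+
  have perm: "{b, i, c} = {1, 2, 3}" "{c, i, b} = {1, 2, 3}" using bc by blast+
  obtain ni nb nc :: int where n: "p \<bullet> xi i = 3 * of_int ni + 1" "p \<bullet> xi b = 3 * of_int nb + 1"
    "p \<bullet> xi c = 3 * of_int nc + 1"
    using v m unfolding grid_vertex_def by meson
  define q where "q = p + edge_vector b c"
  \<comment> \<open>The third vertex of a unit triangle on this edge; its sides have directions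
    \<open>i\<close>, \<open>b\<close> and \<open>c\<close>.\<close>
  define r where "r = p + edge_vector i c"
  have rq: "r - q = edge_vector i b" by (simp add: r_def q_def edge_vector_def algebra_simps)
  have "dist p q = 1" "dist r p = 1"
    using norm_edge_vector[OF bc] norm_edge_vector[OF perm(1)] by (simp_all add: q_def r_def dist_norm)
  moreover have "dist q r = 1"
    using norm_edge_vector[OF perm(2)] rq by (simp add: dist_norm norm_minus_commute[of q])
  moreover have "closed_segment p q \<subseteq> grid"
    by (rule closed_segment_subset_grid[OF m(1), of _ ni])
      (use n inner_edge_vector[OF bc] in \<open>simp_all add: q_def inner_add_left\<close>)
  moreover have "closed_segment r p \<subseteq> grid"
    by (rule closed_segment_subset_grid[OF m(2), of _ nb])
      (use n inner_edge_vector[OF perm(1)] in \<open>simp_all add: r_def inner_add_left\<close>)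
  moreover have "closed_segment q r \<subseteq> grid"
    by (rule closed_segment_subset_grid[OF m(3), of _ "nc - 1"])
      (use n inner_edge_vector[OF perm(1)] inner_edge_vector[OF bc] in \<open>simp_all add: q_def r_def inner_add_left\<close>)
  ultimately have "unit_triangle p q r" unfolding unit_triangle_def by blast
  then show ?thesis unfolding unit_edges_def q_def by blast
qed

lemma rel_interior_edge:
  assumes "{i, b, c} = {1, 2, 3 :: nat}"
  shows "rel_interior (closed_segment p (p + edge_vector b c)) =
    {p + s *\<^sub>R edge_vector b c |s. 0 < s \<and> s < 1}"
proof -
  have "edge_vector b c \<noteq> 0" using norm_edge_vector[OF assms] by auto
  then show ?thesis
    by (auto simp: rel_interior_closed_segment in_segment algebra_simps)
qed

lemma edge_on_line:
  assumes "{i, b, c} = {1, 2, 3 :: nat}" "y \<in> rel_interior (closed_segment p (p + edge_vector b c))"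
  shows "y \<bullet> xi i = p \<bullet> xi i"
  using assms(2) unfolding rel_interior_edge[OF assms(1)]
  by (auto simp: inner_add_left inner_edge_vector[OF assms(1)])

lemma edge_between_lines:
  assumes bc: "{i, b, c} = {1, 2, 3 :: nat}" and p: "grid_vertex p" and l: "l \<in> {1, 2, 3}" "l \<noteq> i"
  obtains n :: int where "\<And>y. y \<in> rel_interior (closed_segment p (p + edge_vector b c)) \<Longrightarrow>
    3 * of_int n + 1 < y \<bullet> xi l \<and> y \<bullet> xi l < 3 * of_int n + 4"
proof -
  obtain n :: int where n: "p \<bullet> xi l = 3 * of_int n + 1" using p l unfolding grid_vertex_def by blast
  have "l = b \<or> l = c" using l bc by blast
  then show thesis
  proof
    assume "l = b"
    then show thesis using n inner_edge_vector[OF bc]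
      by (intro that[of n]) (auto simp: rel_interior_edge[OF bc] inner_add_left)
  next
    assume "l = c"
    then show thesis using n inner_edge_vector[OF bc]
      by (intro that[of "n - 1"]) (auto simp: rel_interior_edge[OF bc] inner_add_left)
  qed
qed

section \<open>Edges relative to the scaled grids\<close>

text \<open>Since -2 is congruent to 1 modulo 3, every line of a grid scaled by a power of -2 is a
  line of the unit grid, so the interior of an edge never crosses it.\<close>

lemma power_neg_two_grid: "\<exists>m'::int. (- 2) ^ n * (3 * m + 1) = 3 * m' + 1" for m :: int
proof (induction n)
  case (Suc n)
  then obtain m' :: int where "(- 2) ^ n * (3 * m + 1) = 3 * m' + 1" by blast
  then have "(- 2) ^ Suc n * (3 * m + 1) = 3 * (- 2 * m' - 1) + 1" by simp
  then show ?case by blast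
qed auto

lemma power_neg_two_grid_real:
  obtains m' :: int where "(- 2) ^ n * (3 * of_int m + 1) = (3 * of_int m' + 1 :: real)"
proof -
  obtain m' where "(- 2) ^ n * (3 * m + 1) = 3 * m' + 1" using power_neg_two_grid by blast
  then have "of_int ((- 2) ^ n * (3 * m + 1)) = (of_int (3 * m' + 1) :: real)" by (simp only:)
  then show thesis using that by simp
qed

lemma edge_off_lines:
  assumes "{i, b, c} = {1, 2, 3 :: nat}" "grid_vertex p" "l \<in> {1, 2, 3}" "l \<noteq> i"
    and y: "y \<in> rel_interior (closed_segment p (p + edge_vector b c))"
  shows "y \<bullet> xi l \<noteq> (- 2) ^ k * (3 * of_int m + 1)"
proof -
  obtain m' :: int where m': "(- 2) ^ k * (3 * of_int m + 1) = (3 * of_int m' + 1 :: real)"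
    by (rule power_neg_two_grid_real)
  obtain n :: int where "3 * of_int n + 1 < y \<bullet> xi l" "y \<bullet> xi l < 3 * of_int n + 4"
    by (rule edge_between_lines[OF assms(1-4)]) (use y in blast)
  then show ?thesis unfolding m' by (auto; linarith)
qed

text \<open>Cells change only at lines of the scaled grid, and none of these runs inside an open
  strip of the unit grid. Exchanging \<open>x\<close> and \<open>y\<close> gives equality.\<close>

lemma cell_mono_between_lines:
  assumes "3 * of_int n + 1 < x \<bullet> xi l" "x \<bullet> xi l < 3 * of_int n + 4"
    and "3 * of_int n + 1 < y \<bullet> xi l" "y \<bullet> xi l < 3 * of_int n + 4"
  shows "cell ((- 2) ^ k) y l \<le> cell ((- 2) ^ k) x l"
proof (rule ccontr)
  let ?c = "(- 2) ^ k :: real"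
  define N where "N = cell ?c x l"
  assume "\<not> ?thesis"
  then have "N < \<lceil>(y \<bullet> xi l / ?c - 1) / 3\<rceil>" by (simp add: N_def cell_def)
  then have "of_int N < (y \<bullet> xi l / ?c - 1) / 3" by (simp add: less_ceiling_iff)
  then have N1: "3 * of_int N + 1 < y \<bullet> xi l / ?c" by simp
  have "(x \<bullet> xi l / ?c - 1) / 3 \<le> of_int N" unfolding N_def cell_def by (rule le_of_int_ceiling)
  then have N2: "x \<bullet> xi l / ?c \<le> 3 * of_int N + 1" by simp
  obtain m :: int where m: "?c * (3 * of_int N + 1) = 3 * of_int m + 1"
    by (rule power_neg_two_grid_real)
  have "?c > 0 \<or> ?c < 0" using linorder_neq_iff[of ?c 0] power_not_zero[of "- 2 :: real" k] by linarith
  \<comment> \<open>The sign of \<open>?c\<close> decides which of the two points comes first; in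
    both cases a unit grid line separates them, although they share a strip.\<close>
  then have "x \<bullet> xi l \<le> 3 * of_int m + 1 \<and> 3 * of_int m + 1 < y \<bullet> xi l \<or>
      y \<bullet> xi l < 3 * of_int m + 1 \<and> 3 * of_int m + 1 \<le> x \<bullet> xi l"
    using N1 N2 unfolding m[symmetric] by (auto simp: field_simps)
  then have "real_of_int n < of_int m" "real_of_int m < of_int (n + 1)" using assms by auto
  then show False by (simp only: of_int_less_iff)
qed

lemma upright_constant_on_edge:
  assumes bc: "{i, b, c} = {1, 2, 3 :: nat}" and p: "grid_vertex p"
    and x: "x \<in> rel_interior (closed_segment p (p + edge_vector b c))"
    and y: "y \<in> rel_interior (closed_segment p (p + edge_vector b c))"
  shows "upright ((- 2) ^ k) x \<longleftrightarrow> upright ((- 2) ^ k) y"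
proof -
  have "cell ((- 2) ^ k) x l = cell ((- 2) ^ k) y l" if l: "l \<in> {1, 2, 3}" for l
  proof (cases "l = i")
    case True
    then show ?thesis using edge_on_line[OF bc x] edge_on_line[OF bc y] by (simp add: cell_def)
  next
    case False
    obtain n :: int where "\<And>y. y \<in> rel_interior (closed_segment p (p + edge_vector b c)) \<Longrightarrow>
        3 * of_int n + 1 < y \<bullet> xi l \<and> y \<bullet> xi l < 3 * of_int n + 4"
      using edge_between_lines[OF bc p l False] by blast
    then show ?thesis using x y by (intro order.antisym cell_mono_between_lines) blast+
  qed
  then show ?thesis unfolding upright_def by (simp cong: sum.cong)
qed

section \<open>The colour of an edge\<close>

text \<open>Folding acts modulo \<open>6 * c\<close> as the identity or as
  \<open>z \<mapsto> 2 * c - z\<close>, and both fix the class of \<open>c\<close>. So the lines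
  that end up on midsegments can be recognized on the unfolded paper.\<close>

lemma folds_to_crease_iff:
  assumes "folds_to (- 2 * c) up x y"
  shows "(\<exists>l\<in>{1, 2, 3}. \<exists>n::int. y \<bullet> xi l = c * (6 * n + 1)) \<longleftrightarrow>
    (\<exists>l\<in>{1, 2, 3}. \<exists>n::int. x \<bullet> xi l = c * (6 * n + 1))"
proof -
  obtain \<pi> where \<pi>: "bij_betw \<pi> {1, 2, 3} {1, 2, 3 :: nat}"
    and y: "\<forall>i\<in>{1, 2, 3}. \<exists>n::int. y \<bullet> xi i =
      (if up then x \<bullet> xi (\<pi> i) else - (- 2 * c) - x \<bullet> xi (\<pi> i)) + 3 * (- 2 * c) * n"
    using assms unfolding folds_to_def by auto
  have "(\<exists>n::int. y \<bullet> xi l = c * (6 * n + 1)) \<longleftrightarrow> (\<exists>n::int. x \<bullet> xi (\<pi> l) = c * (6 * n + 1))"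
    if l: "l \<in> {1, 2, 3}" for l
  proof -
    obtain n :: int where n: "y \<bullet> xi l =
        (if up then x \<bullet> xi (\<pi> l) else - (- 2 * c) - x \<bullet> xi (\<pi> l)) + 3 * (- 2 * c) * n"
      using y l by blast
    have "x \<bullet> xi (\<pi> l) = c * (6 * of_int (if up then m + n else - m - n) + 1)"
      if "y \<bullet> xi l = c * (6 * of_int m + 1)" for m :: int
      using n that by (auto simp: algebra_simps split: if_splits)
    moreover have "y \<bullet> xi l = c * (6 * of_int (if up then m - n else - m - n) + 1)"
      if "x \<bullet> xi (\<pi> l) = c * (6 * of_int m + 1)" for m :: int
      using n that by (auto simp: algebra_simps split: if_splits)
    ultimately show ?thesis by blast
  qed
  then have "(\<exists>l\<in>{1, 2, 3}. \<exists>n::int. y \<bullet> xi l = c * (6 * n + 1)) \<longleftrightarrow>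
      (\<exists>l\<in>{1, 2, 3}. \<exists>n::int. x \<bullet> xi (\<pi> l) = c * (6 * n + 1))" by (intro bex_cong) auto
  also have "\<dots> \<longleftrightarrow> (\<exists>l\<in>\<pi> ` {1, 2, 3}. \<exists>n::int. x \<bullet> xi l = c * (6 * n + 1))" by blast
  finally show ?thesis unfolding bij_betw_imp_surj_on[OF \<pi>] .
qed

lemma faces_up_iff_upright:
  assumes bc: "{i, b, c} = {1, 2, 3 :: nat}" and p: "grid_vertex p"
    and v: "p \<bullet> xi i = (- 2) ^ j * (6 * of_int n + 1)"
    and y: "y \<in> rel_interior (closed_segment p (p + edge_vector b c))"
    and k: "y \<in> big_triangle k" "Suc j \<le> k"
  shows "faces_up k (k - Suc j) y \<longleftrightarrow> upright ((- 2) ^ Suc j) y"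
proof -
  have "position k (k - Suc j) y \<in> big_triangle (Suc j)"
    and f: "folds_to ((- 2) ^ Suc j) (faces_up k (k - Suc j) y) y (position k (k - Suc j) y)"
    using position_folds_to[OF k(1), of "k - Suc j"] k(2) by auto
  moreover have "y \<bullet> xi l \<noteq> (- 2) ^ Suc j * (3 * of_int m + 1)" if l: "l \<in> {1, 2, 3}" for l m
  proof (cases "l = i")
    case True
    \<comment> \<open>Parity: the line of the edge is an odd multiple of \<open>(- 2) ^ j\<close>,
      while the parallel lines of the next coarser grid are even multiples.\<close>
    have "2 * (3 * m + 1) + (6 * n + 1) \<noteq> 0" by presburger
    then have "of_int (2 * (3 * m + 1) + (6 * n + 1)) \<noteq> (0 :: real)" by (simp only: of_int_eq_0_iff) simp
    then have "(- 2) ^ j * (6 * of_int n + 1) \<noteq> (- 2) ^ j * (- 2 * (3 * of_int m + 1) :: real)"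
      by auto
    then show ?thesis unfolding True edge_on_line[OF bc y] v by (simp only: power_Suc2 mult.assoc not_False_eq_True)
  next
    case False
    then show ?thesis using edge_off_lines[OF bc p l False y] by blast
  qed
  ultimately show ?thesis
    by (intro folds_to_imp_upright[OF f]) (auto simp: mem_big_triangle_iff simp del: power_Suc)
qed

text \<open>As \<open>6 * m + 1\<close> is odd, the exponent is the 2-adic valuation.\<close>

lemma power_neg_two_odd_unique:
  assumes "(- 2) ^ j * (6 * of_int m + 1) = ((- 2) ^ j' * (6 * of_int n + 1) :: real)"
  shows "j = j'"
proof -
  have "\<not> j < j'" if "(- 2) ^ j * (6 * of_int m + 1) = ((- 2) ^ j' * (6 * of_int n + 1) :: real)"
    for j j' :: nat and m n :: int
  proof
    assume "j < j'"
    then obtain d where "j' = j + Suc d" by (metis add_Suc_right less_imp_Suc_add)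
    then have "(- 2) ^ j * (6 * of_int m + 1) = (- 2) ^ j * ((- 2) ^ Suc d * (6 * of_int n + 1) :: real)"
      using that by (simp only: power_add mult.assoc)
    then have "6 * of_int m + 1 = ((- 2) ^ Suc d * (6 * of_int n + 1) :: real)"
      by (simp del: power_Suc)
    then have "of_int (6 * m + 1) = (of_int ((- 2) ^ Suc d * (6 * n + 1)) :: real)" by simp
    then have "6 * m + 1 = (- 2) ^ Suc d * (6 * n + 1)" by (simp only: of_int_eq_iff)
    then have "even (6 * m + 1)" by simp
    then show False by simp
  qed
  then show ?thesis using assms by (metis linorder_neqE_nat)
qed

lemma folding_pattern_colour:
  assumes bc: "{i, b, c} = {1, 2, 3 :: nat}" and p: "grid_vertex p"
    and v: "p \<bullet> xi i = (- 2) ^ j * (6 * of_int n + 1)"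
    and e: "(closed_segment p (p + edge_vector b c), col) \<in> folding_pattern a"
    and y: "y \<in> rel_interior (closed_segment p (p + edge_vector b c))"
  shows "col = crease_colour (a (Suc j)) (upright ((- 2) ^ Suc j) y)"
proof -
  obtain k j' where j': "j' \<in> {1..k}" and int: "interior_edge k (closed_segment p (p + edge_vector b c))"
    and fr: "position k (k - j') y \<in> frontier (big_triangle (j' - 1))"
    and col: "col = crease_colour (a j') (faces_up k (k - j') y)"
    using e y unfolding folding_pattern_def finite_pattern_def by blast
  obtain j0 where j0: "j' = Suc j0" using j' by (cases j') auto
  have k: "y \<in> big_triangle k"
    using int y interior_subset unfolding interior_edge_def by blast
  have "folds_to (- 2 * (- 2) ^ j0) (faces_up k (k - j') y) y (position k (k - j') y)"
    using position_folds_to[OF k, of "k - j'"] j' j0 by auto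
  moreover obtain l where "l \<in> {1, 2, 3}" "position k (k - j') y \<bullet> xi l = (- 2) ^ j0 * (6 * of_int 0 + 1)"
    using fr unfolding frontier_big_triangle j0 by auto
  ultimately obtain l m where l: "l \<in> {1, 2, 3}" and m: "y \<bullet> xi l = (- 2) ^ j0 * (6 * of_int m + 1)"
    using folds_to_crease_iff by blast
  have "l = i"
  proof (rule ccontr)
    assume "l \<noteq> i"
    from edge_off_lines[OF bc p l this y, of j0 "2 * m"] m show False by simp
  qed
  then have "j = j0" using m v edge_on_line[OF bc y] power_neg_two_odd_unique by metis
  then show ?thesis using faces_up_iff_upright[OF bc p v y k] col j' j0 by auto
qed

lemma folding_pattern_exists:
  assumes bc: "{i, b, c} = {1, 2, 3 :: nat}" and p: "grid_vertex p"
    and v: "p \<bullet> xi i = (- 2) ^ j * (6 * of_int n + 1)"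
  obtains col where "(closed_segment p (p + edge_vector b c), col) \<in> folding_pattern a"
proof -
  let ?e = "closed_segment p (p + edge_vector b c)"
  \<comment> \<open>Along the edge each coordinate differs from that of \<open>p\<close> by at most
    3, so this size puts the edge inside the triangle.\<close>
  obtain k0 where k0: "\<bar>p \<bullet> xi 1\<bar> + \<bar>p \<bullet> xi 2\<bar> + \<bar>p \<bullet> xi 3\<bar> + 3 < (2 :: real) ^ k0"
    using real_arch_pow[of 2] by auto
  define k where "k = max k0 (Suc j)"
  have jk: "Suc j \<le> k" by (simp add: k_def)
  have "(2 :: real) ^ k0 \<le> 2 ^ k" by (intro power_increasing) (auto simp: k_def)
  with k0 have k0: "\<bar>p \<bullet> xi 1\<bar> + \<bar>p \<bullet> xi 2\<bar> + \<bar>p \<bullet> xi 3\<bar> + 3 < (2 :: real) ^ k" by linarith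
  have big: "\<bar>p \<bullet> xi l\<bar> + 3 < 2 ^ k" if "l \<in> {1, 2, 3}" for l using that k0 by (elim insertE emptyE) simp_all
  have ins: "rel_interior ?e \<subseteq> interior (big_triangle k)"
  proof
    fix y assume y: "y \<in> rel_interior ?e"
    have "y \<bullet> xi l / (- 2) ^ k < 1" if l: "l \<in> {1, 2, 3}" for l
    proof -
      obtain s where s: "0 < s" "s < 1" "y = p + s *\<^sub>R edge_vector b c"
        using y unfolding rel_interior_edge[OF bc] by blast
      have "l = i \<or> l = b \<or> l = c" using l bc by blast
      then have "\<bar>edge_vector b c \<bullet> xi l\<bar> \<le> 3" using inner_edge_vector[OF bc] by auto
      then have "\<bar>s * (edge_vector b c \<bullet> xi l)\<bar> \<le> 1 * 3"
        unfolding abs_mult using s by (intro mult_mono) auto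
      then have "\<bar>y \<bullet> xi l\<bar> < 2 ^ k" using big[OF l] by (simp add: s inner_add_left)
      then have "\<bar>y \<bullet> xi l / (- 2) ^ k\<bar> < 1" by (simp add: power_abs)
      then show ?thesis by linarith
    qed
    then show "y \<in> interior (big_triangle k)" unfolding interior_big_triangle by blast
  qed
  then have k: "y \<in> big_triangle k" if "y \<in> rel_interior ?e" for y using that interior_subset by blast
  have fr: "position k (k - Suc j) y \<in> frontier (big_triangle j)" if y: "y \<in> rel_interior ?e" for y
  proof -
    let ?q = "position k (k - Suc j) y" and ?c = "(- 2) ^ j :: real"
    have q: "?q \<in> big_triangle (Suc j)" and f: "folds_to (- 2 * ?c) (faces_up k (k - Suc j) y) y ?q"
      using position_folds_to[OF k[OF y], of "k - Suc j"] jk by auto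
    have c: "?c \<noteq> 0" by simp
    have ge: "?q \<bullet> xi l / ?c \<ge> - 2" if "l \<in> {1, 2, 3}" for l
      using q that unfolding mem_big_triangle_iff by auto
    have "i \<in> {1, 2, 3}" using bc by blast
    then obtain l m where l: "l \<in> {1, 2, 3}" and m: "?q \<bullet> xi l = ?c * (6 * of_int m + 1)"
      using folds_to_crease_iff[OF f] v edge_on_line[OF bc y] by metis
    obtain b' c' where l': "{l, b', c'} = {1, 2, 3}" using l by (rule xi_permutationE)
    have sum: "?q \<bullet> xi l / ?c + ?q \<bullet> xi b' / ?c + ?q \<bullet> xi c' / ?c = 0"
      using sum_inner_xi[OF l', of ?q] by (simp add: add_divide_distrib[symmetric])
    have "b' \<in> {1, 2, 3}" "c' \<in> {1, 2, 3}" using l' by blast+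
    note ge' = ge[OF l] ge[OF this(1)] ge[OF this(2)]
    have ml: "?q \<bullet> xi l / ?c = 6 * of_int m + 1" using m c by simp
    \<comment> \<open>Three numbers that are at least -2 and sum to 0 are at most 4, which leaves
      only 1 among the values \<open>6 * m + 1\<close>. The other two then sum to -1, so each is at
      most 1.\<close>
    have "- 1 < m" "m < 1" using ml ge' sum by linarith+
    then have "m = 0" by simp
    then have "?q \<bullet> xi l / ?c \<le> 1" "?q \<bullet> xi b' / ?c \<le> 1" "?q \<bullet> xi c' / ?c \<le> 1"
      using ml ge' sum by (simp_all only: of_int_0)
    then have "\<forall>i\<in>{l, b', c'}. ?q \<bullet> xi i / ?c \<le> 1" by simp
    then have "?q \<in> big_triangle j" unfolding mem_big_triangle_iff l' .
    then show ?thesis unfolding frontier_big_triangle using l m \<open>m = 0\<close> by auto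
  qed
  \<comment> \<open>The midpoint serves as a sample; by constancy of \<open>upright\<close> along
    the edge its colour is the colour everywhere.\<close>
  define y0 where "y0 = p + (1 / 2) *\<^sub>R edge_vector b c"
  have y0: "y0 \<in> rel_interior ?e" unfolding rel_interior_edge[OF bc] y0_def
    by (auto intro!: exI[of _ "1 / 2"])
  define col where "col = crease_colour (a (Suc j)) (upright ((- 2) ^ Suc j) y0)"
  have "col = crease_colour (a (Suc j)) (faces_up k (k - Suc j) y)" if y: "y \<in> rel_interior ?e" for y
    unfolding col_def faces_up_iff_upright[OF bc p v y k[OF y] jk] upright_constant_on_edge[OF bc p y0 y] ..
  moreover have "interior_edge k ?e" unfolding interior_edge_def using unit_edgeI[OF p bc] ins by blast
  moreover have "Suc j \<in> {1..k}" using jk by simp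
  ultimately have "(?e, col) \<in> finite_pattern a k"
    unfolding finite_pattern_def using fr
    by (intro CollectI case_prodI conjI bexI[of _ "Suc j"]) auto
  then show thesis using that unfolding folding_pattern_def by blast
qed

lemma folding_pattern_unit_edge: "(e, col) \<in> folding_pattern a \<Longrightarrow> e \<in> unit_edges"
  unfolding folding_pattern_def finite_pattern_def interior_edge_def by blast

section \<open>Periods\<close>

lemma point_with_coordinates:
  assumes "{i, b, c} = {1, 2, 3 :: nat}"
  obtains p where "p \<bullet> xi i = v" "p \<bullet> xi b = w"
proof -
  have m: "i \<in> {1, 2, 3}" "b \<in> {1, 2, 3}" using assms by blast+
  have "distinct [i, b, c]" using assms by (rule distinct_xi_indices)
  then have "i \<noteq> b" by simp
  \<comment> \<open>The coefficients come from inverting the Gram matrix with entries 12 and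
    -6.\<close>
  define p where "p = ((2 * v + w) / 18) *\<^sub>R xi i + ((v + 2 * w) / 18) *\<^sub>R xi b"
  have "p \<bullet> xi i = v" "p \<bullet> xi b = w"
    using inner_xi_xi[OF m(1) m(1)] inner_xi_xi[OF m(1) m(2)] inner_xi_xi[OF m(2) m(1)]
      inner_xi_xi[OF m(2) m(2)] \<open>i \<noteq> b\<close>
    by (simp_all add: p_def inner_add_left field_simps)
  then show thesis using that by blast
qed

text \<open>Two edges on one line at distance \<open>\<bar>v\<bar>\<close>, its run length, have
  different colours. Their translates lie on a line with runs half as long, where this distance is a
  full period.\<close>

lemma period_inner_xi_eq_0:
  assumes period: "translate_pattern t (folding_pattern a) = folding_pattern a"
    and bc: "{i, b, c} = {1, 2, 3 :: nat}"
  shows "t \<bullet> xi i = 0"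
proof (rule ccontr)
  assume t0: "t \<bullet> xi i \<noteq> 0"
  let ?d = "edge_vector b c"
  have i: "i \<in> {1, 2, 3}" using bc by blast
  have ibc: "sum f {1, 2, 3} = f i + f b + f c" for f :: "nat \<Rightarrow> int"
  proof -
    have "distinct [i, b, c]" using bc by (rule distinct_xi_indices)
    then show ?thesis unfolding bc[symmetric] by simp
  qed
  note d = inner_edge_vector[OF bc]
  have shift: "(closed_segment (p + t) (p + t + ?d), col) \<in> folding_pattern a"
    if "(closed_segment p (p + ?d), col) \<in> folding_pattern a" for p col
  proof -
    have "(\<lambda>x. x + t) ` closed_segment p (p + ?d) = closed_segment (p + t) (p + t + ?d)"
      using closed_segment_translation[of t p "p + ?d"] by (simp only: add.commute[of _ t] add.assoc[symmetric])
    then have "(closed_segment (p + t) (p + t + ?d), col) \<in> translate_pattern t (folding_pattern a)"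
      unfolding translate_pattern_def using that
      by (intro image_eqI[of _ _ "(closed_segment p (p + ?d), col)"]) auto
    then show ?thesis unfolding period .
  qed
  have shift_vertex: "grid_vertex (p + t)"
    if "(closed_segment p (p + ?d), col) \<in> folding_pattern a" for p col
    using shift[OF that] folding_pattern_unit_edge unit_edge_grid_vertex by blast

  \<comment> \<open>The translate of an edge of the pattern is again a unit edge, so
    \<open>t\<close> moves a grid vertex to a grid vertex.\<close>
  obtain m :: int where m: "t \<bullet> xi i = 3 * of_int m"
  proof -
    obtain p where pi: "p \<bullet> xi i = 1" and pb: "p \<bullet> xi b = 1"
      using bc by (rule point_with_coordinates)
    have "grid_vertex p" using pi pb by (intro grid_vertexI[OF bc, of _ 0 0]) auto
    moreover have "p \<bullet> xi i = (- 2) ^ 0 * (6 * of_int 0 + 1)" using pi by simp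
    ultimately obtain col where "(closed_segment p (p + ?d), col) \<in> folding_pattern a"
      by (rule folding_pattern_exists[OF bc])
    then have "grid_vertex (p + t)" by (rule shift_vertex)
    then obtain n :: int where "(p + t) \<bullet> xi i = 3 * of_int n + 1" using i unfolding grid_vertex_def by blast
    then have "t \<bullet> xi i = 3 * of_int n" using pi by (simp add: inner_add_left)
    then show thesis by (rule that)
  qed
  then have "m \<noteq> 0" using t0 by auto
  then obtain s r where mr: "m = (- 2) ^ s * r" and "odd r"
  proof -
    define k where "k = multiplicity 2 m"
    obtain r where "m = 2 ^ k * r" "odd r"
      using multiplicity_decompose'[of m 2] \<open>m \<noteq> 0\<close> unfolding k_def by auto
    moreover have "(- 2) ^ k * (- 1) ^ k = (2 ^ k :: int)" by (simp flip: power_mult_distrib)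
    ultimately show thesis
      \<comment> \<open>Powers of -2 match the scales of the triangles; the sign is absorbed into
        the odd factor.\<close>
      by (intro that[of k "(- 1) ^ k * r"]) (simp_all add: mult.assoc[symmetric])
  qed
  then obtain q where r: "r = 2 * q + 1" by (auto elim: oddE)

  define v :: real where "v = (- 2) ^ Suc s"
  have "\<bar>v\<bar> = 2 * 2 ^ s" by (simp add: v_def abs_mult power_abs)
  then have v2: "\<bar>v\<bar> \<ge> 2" by simp
  then have v0: "v \<noteq> 0" by auto
  then have w: "\<bar>1 / (4 * v)\<bar> \<le> 1 / 8" using v2 by (simp add: field_simps abs_mult)
  obtain nv :: int where "(- 2) ^ Suc s * (3 * of_int 0 + 1) = 3 * real_of_int nv + 1"
    by (rule power_neg_two_grid_real)
  then have nv: "v = 3 * of_int nv + 1" by (simp add: v_def)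
  obtain p where pi: "p \<bullet> xi i = v" and pb: "p \<bullet> xi b = - 2"
    using bc by (rule point_with_coordinates)
  have pc: "p \<bullet> xi c = 2 - v" using sum_inner_xi[OF bc, of p] pi pb by simp
  \<comment> \<open>A shift by \<open>\<bar>v\<bar>\<close> unit steps along the line.\<close>
  define p' where "p' = p - v *\<^sub>R ?d"
  have p'i: "p' \<bullet> xi i = v" and p'b: "p' \<bullet> xi b = - 2 - 3 * v" and p'c: "p' \<bullet> xi c = 2 + 2 * v"
    using pi pb pc d by (simp_all add: p'_def inner_diff_left)
  have gp: "grid_vertex p" using pi pb nv by (intro grid_vertexI[OF bc, of _ nv "-1"]) auto
  have gp': "grid_vertex p'"
    using p'i p'b nv by (intro grid_vertexI[OF bc, of _ nv "- 3 * nv - 2"]) auto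
  have lv: "p \<bullet> xi i = (- 2) ^ Suc s * (6 * of_int 0 + 1)" "p' \<bullet> xi i = (- 2) ^ Suc s * (6 * of_int 0 + 1)"
    using pi p'i by (simp_all add: v_def)
  obtain col where col: "(closed_segment p (p + ?d), col) \<in> folding_pattern a"
    using folding_pattern_exists[OF bc gp lv(1)] .
  obtain col' where col': "(closed_segment p' (p' + ?d), col') \<in> folding_pattern a"
    using folding_pattern_exists[OF bc gp' lv(2)] .
  define h where "h = (1 / 2) *\<^sub>R ?d"
  have mid: "x + h \<in> rel_interior (closed_segment x (x + ?d))" for x
    unfolding rel_interior_edge[OF bc] h_def by (auto intro!: exI[of _ "1 / 2"])
  have h: "h \<bullet> xi i = 0" "h \<bullet> xi b = 3 / 2" "h \<bullet> xi c = - 3 / 2" using d by (simp_all add: h_def)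

  \<comment> \<open>At level \<open>s + 2\<close> the two edges are midsegments of adjacent triangles.\<close>
  have V: "(- 2) ^ Suc (Suc s) = - 2 * v" by (simp add: v_def)
  have "cell (- 2 * v) (p + h) i = 0" "cell (- 2 * v) (p + h) b = 0" "cell (- 2 * v) (p + h) c = 0"
  proof -
    have "(p + h) \<bullet> xi i / (- 2 * v) = - 1 / 2" "(p + h) \<bullet> xi b / (- 2 * v) = 1 / (4 * v)"
      "(p + h) \<bullet> xi c / (- 2 * v) = 1 / 2 - 1 / (4 * v)"
      unfolding inner_add_left pi pb pc h using v0 by (simp_all add: field_simps)
    then show "cell (- 2 * v) (p + h) i = 0" "cell (- 2 * v) (p + h) b = 0" "cell (- 2 * v) (p + h) c = 0"
      using w by - (rule cell_eqI; simp only: of_int_0 of_int_1 abs_le_iff; linarith)+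
  qed
  then have up: "upright (- 2 * v) (p + h)" by (simp only: upright_def ibc)
  have "cell (- 2 * v) (p' + h) i = 0" "cell (- 2 * v) (p' + h) b = 1" "cell (- 2 * v) (p' + h) c = 0"
  proof -
    have "(p' + h) \<bullet> xi i / (- 2 * v) = - 1 / 2" "(p' + h) \<bullet> xi b / (- 2 * v) = 3 / 2 + 1 / (4 * v)"
      "(p' + h) \<bullet> xi c / (- 2 * v) = - 1 - 1 / (4 * v)"
      unfolding inner_add_left p'i p'b p'c h using v0 by (simp_all add: field_simps)
    then show "cell (- 2 * v) (p' + h) i = 0" "cell (- 2 * v) (p' + h) b = 1" "cell (- 2 * v) (p' + h) c = 0"
      using w by - (rule cell_eqI; simp only: of_int_0 of_int_1 abs_le_iff; linarith)+
  qed
  then have down: "\<not> upright (- 2 * v) (p' + h)" by (simp only: upright_def ibc)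
  have "col = crease_colour (a (Suc (Suc s))) True"
    using folding_pattern_colour[OF bc gp lv(1) col mid] up unfolding V by simp
  moreover have "col' = crease_colour (a (Suc (Suc s))) False"
    using folding_pattern_colour[OF bc gp' lv(2) col' mid] down unfolding V by simp
  ultimately have "col \<noteq> col'" by (simp add: crease_colour_def)

  \<comment> \<open>The translated edges are creased at level \<open>s + 1\<close>, where they differ by a period of the grid.\<close>
  have "v + 3 * of_int m = (- 2) ^ s * (6 * of_int q + 1)"
    by (simp add: v_def mr r algebra_simps)
  then have lt: "(p + t) \<bullet> xi i = (- 2) ^ s * (6 * of_int q + 1)"
      "(p' + t) \<bullet> xi i = (- 2) ^ s * (6 * of_int q + 1)"
    using pi p'i m by (simp_all add: inner_add_left)
  have "cell v (p' + t + h) i = cell v (p + t + h) i"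
    by (simp add: cell_def inner_add_left pi p'i)
  \<comment> \<open>In units of \<open>v\<close> the shift changes coordinates \<open>b\<close> and
    \<open>c\<close> by -3 and 3, so the two changes of cell cancel in the sum.\<close>
  moreover have "cell v (p' + t + h) b = cell v (p + t + h) b - 1"
  proof -
    have "((p' + t + h) \<bullet> xi b / v - 1) / 3 = ((p + t + h) \<bullet> xi b / v - 1) / 3 - of_int 1"
      using v0 by (simp add: inner_add_left pb p'b field_simps)
    then show ?thesis unfolding cell_def by (simp only: ceiling_diff_of_int)
  qed
  moreover have "cell v (p' + t + h) c = cell v (p + t + h) c + 1"
  proof -
    have "((p' + t + h) \<bullet> xi c / v - 1) / 3 = ((p + t + h) \<bullet> xi c / v - 1) / 3 + of_int 1"
      using v0 by (simp add: inner_add_left pc p'c field_simps)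
    then show ?thesis unfolding cell_def by (simp only: ceiling_add_of_int)
  qed
  ultimately have "upright v (p' + t + h) \<longleftrightarrow> upright v (p + t + h)"
    unfolding upright_def ibc by linarith
  moreover have "col = crease_colour (a (Suc s)) (upright v (p + t + h))"
    unfolding v_def by (rule folding_pattern_colour[OF bc shift_vertex[OF col] lt(1) shift[OF col] mid])
  moreover have "col' = crease_colour (a (Suc s)) (upright v (p' + t + h))"
    unfolding v_def by (rule folding_pattern_colour[OF bc shift_vertex[OF col'] lt(2) shift[OF col'] mid])
  ultimately show False using \<open>col \<noteq> col'\<close> by simp
qed

theorem theorem3p6:
  fixes a :: "nat \<Rightarrow> folding" and t :: "real^2"
  assumes "translate_pattern t (folding_pattern a) = folding_pattern a"
  shows "t = 0"
proof -
  have "t \<bullet> xi 1 = 0" "t \<bullet> xi 2 = 0"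
    by (rule period_inner_xi_eq_0[OF assms, of 1 2 3], simp,
        rule period_inner_xi_eq_0[OF assms, of 2 1 3], auto)
  then show ?thesis by (simp add: inner_xi_simps vec_eq_iff forall_2)
qed

end
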